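(* Let $\mathbf{t}=x_1x_2\cdots x_k$ be a finite binary code (each $x_i\in\{0,1\}$), regarded as a finite traversal of the tree $X$ from its root. Then $F[\mathbf{t}]=F[\mathrm{refl}(\mathbf{t})]$.
   Context: Define $\tau_0,\tau_1:\mathbb{Z}^3\to\mathbb{Z}^3$ by $\tau_0([a,b,c])=[a,c,a+c]$ and $\tau_1([a,b,c])=[b,c,b+c]$. The root state is $S_1=[1,2,3]$. For a binary code $x_1x_2\cdots x_k$ with $x_i\in\{0,1\}$, the state $S[x_1x_2\cdots x_k]$ is $\tau_{x_k}\circ\cdots\circ\tau_{x_2}\circ\tau_{x_1}([1,2,3])$, and $F[x_1x_2\cdots x_k]$ denotes the third entry of the vector $S[x_1x_2\cdots x_k]$. $X$ is the infinite directed rooted binary tree whose root is labelled $[1,2,3]$ and in which the vertex reached by the traversal $x_1\cdots x_k$ (following out-edges labelled $x_1,\dots,x_k$) is labelled with the state $S[x_1\cdots x_k]$. The reflection of a code is its reversal: $\mathrm{refl}(x_1x_2\cdots x_k)=x_kx_{k-1}\cdots x_1$. *)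

theory Defs
  imports Main
begin

type_synonym state = "int \<times> int \<times> int"

text \<open>Binary codes: the digit 0 is \<^term>\<open>False\<close>, the digit 1 is \<^term>\<open>True\<close>.\<close>

type_synonym code = "bool list"

fun tau0 :: "state \<Rightarrow> state" where
  "tau0 (a, b, c) = (a, c, a + c)"

fun tau1 :: "state \<Rightarrow> state" where
  "tau1 (a, b, c) = (b, c, b + c)"

definition tau :: "bool \<Rightarrow> state \<Rightarrow> state" where
  "tau x = (if x then tau1 else tau0)"

definition root_state :: state where
  "root_state = (1, 2, 3)"

text \<open>
  The first digit of the code acts first. The vertices of the infinite rooted binary tree
  are identified with the codes of the traversals that reach them from the root
  (the root is the empty code), so \<open>S\<close> is also the vertex labelling of the tree.
\<close>

definition S :: "code \<Rightarrow> state" where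
  "S t = fold tau t root_state"

definition F :: "code \<Rightarrow> int" where
  "F t = (case S t of (a, b, c) \<Rightarrow> c)"

abbreviation reflection :: "code \<Rightarrow> code" where
  "reflection t \<equiv> rev t"

end

theory Submission
  imports Defs
begin

text \<open>
  The root lies in the plane \<open>a + b = c\<close>, which both maps preserve. On this plane, with the
  coordinates \<open>(a, b)\<close>, the maps are linear, with matrices \<open>[[1, 0], [1, 1]]\<close> and
  \<open>[[0, 1], [1, 1]]\<close>. Up to scaling there is exactly one symmetric bilinear form for which both
  are self-adjoint (\<open>reflection_form_tau\<close>), and pairing with the root \<open>(1, 2)\<close> under this form
  reads off \<open>a + b = c\<close> (\<open>reflection_form_root\<close>). Writing \<open>T\<close> for the composition of maps
  belonging to a code and \<open>r\<close> for the root, the adjoint of \<open>T\<close> is the composition in the opposite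
  order, which belongs to the reflected code. Therefore \<open>\<langle>T r, r\<rangle> = \<langle>r, T\<^sup>* r\<rangle>\<close> equates the third
  entries of the two states.
\<close>

fun additive_state :: "state \<Rightarrow> bool" where
  "additive_state (a, b, c) \<longleftrightarrow> a + b = c"

text \<open>
  The Gram matrix \<open>P = [[-1, 1], [1, 0]]\<close> is the solution, unique up to scaling, of the linear
  equations saying that \<open>P\<close> and its products with the two matrices above are symmetric; the scale
  is chosen so that pairing with the root gives the third entry itself and not a multiple of it.
\<close>

fun reflection_form :: "state \<Rightarrow> state \<Rightarrow> int" where
  "reflection_form (a, b, c) (a', b', c') = a * b' + b * a' - a * a'"

lemma reflection_form_commute: "reflection_form x y = reflection_form y x"
  by (cases x; cases y) (simp add: algebra_simps)

lemma reflection_form_root: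
  assumes "additive_state (a, b, c)"
  shows "reflection_form root_state (a, b, c) = c"
  using assms by (simp add: root_state_def)

lemma additive_root_state: "additive_state root_state"
  by (simp add: root_state_def)

lemma additive_state_tau:
  assumes "additive_state x"
  shows "additive_state (tau d x)"
  using assms by (cases x) (auto simp: tau_def)

lemma additive_state_fold_tau:
  assumes "additive_state x"
  shows "additive_state (fold tau t x)"
  using assms by (induction t arbitrary: x) (simp_all add: additive_state_tau)

lemma reflection_form_tau:
  assumes "additive_state x" and "additive_state y"
  shows "reflection_form (tau d x) y = reflection_form x (tau d y)"
  using assms by (cases x; cases y) (auto simp: tau_def algebra_simps)

text \<open>
  Taking adjoints reverses the order of composition; this is where the reflection of the code
  comes from.
\<close>

lemma reflection_form_fold_tau:
  assumes "additive_state x" and "additive_state y"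
  shows "reflection_form (fold tau t x) y = reflection_form x (fold tau (reflection t) y)"
  using assms(1)
proof (induction t arbitrary: x)
  case Nil
  show ?case by simp
next
  case (Cons d t)
  have "reflection_form (fold tau (d # t) x) y
      = reflection_form (tau d x) (fold tau (reflection t) y)"
    using Cons by (simp add: additive_state_tau)
  also have "\<dots> = reflection_form x (tau d (fold tau (reflection t) y))"
    using Cons.prems assms(2) by (simp add: reflection_form_tau additive_state_fold_tau)
  finally show ?case by simp
qed

lemma F_eq_reflection_form: "F t = reflection_form root_state (S t)"
proof -
  obtain a b c where abc: "S t = (a, b, c)"
    by (cases "S t")
  have "additive_state (S t)"
    by (simp add: S_def additive_state_fold_tau additive_root_state)
  then show ?thesis
    by (simp only: F_def abc prod.case reflection_form_root)
qed

theorem theorem2p3: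
  fixes t :: code
  shows "F t = F (reflection t)"
proof -
  have "F t = reflection_form (S t) root_state"
    by (simp only: F_eq_reflection_form reflection_form_commute)
  also have "\<dots> = reflection_form root_state (S (reflection t))"
    by (simp only: S_def reflection_form_fold_tau additive_root_state)
  also have "\<dots> = F (reflection t)"
    by (simp only: F_eq_reflection_form)
  finally show ?thesis .
qed

end
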